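(* Let $P$ be a poset and let $g : \mathcal{P}(P) \to \mathcal{P}(P)$ be a function. Then the family of all chains of $P$ that are good for $g$ has a maximum under inclusion; that is, there exists a chain $U \subseteq P$ that is good for $g$ and such that $C \subseteq U$ for every chain $C \subseteq P$ that is good for $g$.
   Context: $\mathcal{P}(X)$ denotes the powerset of a set $X$. A chain in a poset $P$ is a linearly ordered subset of $P$ (the empty set is a chain). For $S \subseteq C \subseteq P$, $S$ is an (initial) segment of $C$, written $S \sqsubseteq C$, if for all $x \in C$ and $y \in S$, $x \leq y$ implies $x \in S$ (so $S \sqsubseteq C$ includes $S \subseteq C$). One writes $S \sqsubset C$ if $S \sqsubseteq C$ and $S \neq C$. Given $g : \mathcal{P}(P) \to \mathcal{P}(P)$, a chain $C \subseteq P$ is good for $g$ if for all $S \sqsubset C$ one has $S \sqsubset g(S)$ and $g(S) \sqsubseteq C$. *)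

theory Defs
  imports Main "HOL-Library.FuncSet"
begin

definition segment :: "'a rel \<Rightarrow> 'a set \<Rightarrow> 'a set \<Rightarrow> bool" where
  "segment r S C \<longleftrightarrow> S \<subseteq> C \<and> (\<forall>x\<in>C. \<forall>y\<in>S. (x, y) \<in> r \<longrightarrow> x \<in> S)"

definition strict_segment :: "'a rel \<Rightarrow> 'a set \<Rightarrow> 'a set \<Rightarrow> bool" where
  "strict_segment r S C \<longleftrightarrow> segment r S C \<and> S \<noteq> C"

definition good_chain :: "'a set \<Rightarrow> 'a rel \<Rightarrow> ('a set \<Rightarrow> 'a set) \<Rightarrow> 'a set \<Rightarrow> bool" where
  "good_chain P r g C \<longleftrightarrow>
     C \<subseteq> P \<and> C \<in> Chains r \<and>
     (\<forall>S. strict_segment r S C \<longrightarrow> strict_segment r S (g S) \<and> segment r (g S) C)"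

end

theory Submission
  imports Defs
begin

text \<open>A good chain \<open>C\<close> is determined step by step: whenever a proper segment \<open>S\<close> of \<open>C\<close> has
  been reached, \<open>C\<close> must continue with \<open>g S\<close>, which properly extends \<open>S\<close>. Two good chains
  therefore cannot diverge: at the largest common segment \<open>S\<close> of \<open>C\<close> and \<open>D\<close>, either one of the
  chains is exhausted, or \<open>g S\<close> is a strictly larger common segment, which is absurd. Hence one of
  any two good chains is a segment of the other (\<open>good_chains_segment_linear\<close>).

  It follows that the union \<open>U\<close> of all good chains is a chain having each good chain as a segment.
  A proper segment \<open>S\<close> of \<open>U\<close> misses some element of some good chain \<open>C\<close>, and is then a proper
  segment of \<open>C\<close>; so the conditions on \<open>S\<close> and \<open>g S\<close> are inherited from \<open>C\<close>. Thus \<open>U\<close> is good,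
  and it contains all good chains by construction.\<close>

lemma segment_trans: "segment r A B \<Longrightarrow> segment r B C \<Longrightarrow> segment r A C"
  unfolding segment_def by blast

lemma segment_restrict: "segment r S U \<Longrightarrow> S \<subseteq> C \<Longrightarrow> C \<subseteq> U \<Longrightarrow> segment r S C"
  unfolding segment_def by blast

lemma segment_Union: "(\<And>S. S \<in> \<S> \<Longrightarrow> segment r S C) \<Longrightarrow> segment r (\<Union>\<S>) C"
  unfolding segment_def by blast

lemma Chains_linear: "C \<in> Chains r \<Longrightarrow> x \<in> C \<Longrightarrow> y \<in> C \<Longrightarrow> (x, y) \<in> r \<or> (y, x) \<in> r"
  unfolding Chains_def by blast

text \<open>If a proper segment \<open>S\<close> of a chain \<open>U\<close> misses a point \<open>x\<close>, all of \<open>S\<close> lies below \<open>x\<close>; so a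
  segment \<open>C\<close> of \<open>U\<close> containing \<open>x\<close> swallows \<open>S\<close>.\<close>

lemma strict_segment_of_segment:
  assumes "U \<in> Chains r" "segment r S U" "segment r C U" "x \<in> C" "x \<notin> S"
  shows "strict_segment r S C"
proof -
  have "S \<subseteq> C"
  proof
    fix y assume "y \<in> S"
    moreover have "x \<in> U" "y \<in> U"
      using assms \<open>y \<in> S\<close> by (auto simp: segment_def)
    ultimately have "(y, x) \<in> r"
      using assms Chains_linear[of U r x y] by (auto simp: segment_def)
    then show "y \<in> C"
      using assms \<open>y \<in> U\<close> by (auto simp: segment_def)
  qed
  moreover have "C \<subseteq> U"
    using assms(3) by (simp add: segment_def)
  ultimately have "segment r S C"
    using segment_restrict[OF assms(2)] by blast
  then show ?thesis
    using assms(4,5) by (auto simp: strict_segment_def)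
qed

text \<open>Common segments are closed under unions, so a largest one exists; applying \<open>g\<close> to it would
  enlarge it unless it is all of \<open>C\<close> or all of \<open>D\<close>.\<close>

lemma good_chains_segment_linear:
  assumes C: "good_chain P r g C" and D: "good_chain P r g D"
  shows "segment r C D \<or> segment r D C"
proof (rule ccontr)
  assume not: "\<not> ?thesis"
  define S where "S = \<Union>{T. segment r T C \<and> segment r T D}"
  have SC: "segment r S C" and SD: "segment r S D"
    unfolding S_def by (rule segment_Union, simp)+
  with not have "strict_segment r S C" "strict_segment r S D"
    by (auto simp: strict_segment_def)
  with C D have g: "strict_segment r S (g S)" "segment r (g S) C" "segment r (g S) D"
    by (auto simp: good_chain_def)
  then have "g S \<subseteq> S"
    unfolding S_def by blast
  with g(1) show False
    by (auto simp: strict_segment_def segment_def)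
qed

text \<open>Of two good chains one is contained in the other, with no new elements inserted below old
  ones; so their union preserves both linearity and segments.\<close>

lemma Union_good_chains:
  fixes P r g
  defines "U \<equiv> \<Union>{C. good_chain P r g C}"
  shows "U \<in> Chains r"
    and "good_chain P r g C \<Longrightarrow> segment r C U"
proof -
  show "U \<in> Chains r"
    unfolding Chains_def
  proof (intro CollectI ballI)
    fix x y assume "x \<in> U" "y \<in> U"
    then obtain C D where CD: "good_chain P r g C" "x \<in> C" "good_chain P r g D" "y \<in> D"
      unfolding U_def by blast
    then have "C \<subseteq> D \<or> D \<subseteq> C"
      using good_chains_segment_linear[of P r g C D] by (auto simp: segment_def)
    then show "(x, y) \<in> r \<or> (y, x) \<in> r"
      using CD Chains_linear[of C r x y] Chains_linear[of D r x y]
      by (auto simp: good_chain_def)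
  qed
next
  assume C: "good_chain P r g C"
  show "segment r C U"
    unfolding segment_def
  proof (intro conjI ballI impI)
    show "C \<subseteq> U"
      using C unfolding U_def by blast
  next
    fix x y assume "x \<in> U" "y \<in> C" "(x, y) \<in> r"
    then obtain D where "good_chain P r g D" "x \<in> D"
      unfolding U_def by blast
    then show "x \<in> C"
      using good_chains_segment_linear[OF C, of D] \<open>y \<in> C\<close> \<open>(x, y) \<in> r\<close>
      by (auto simp: segment_def)
  qed
qed

theorem theorem4:
  fixes P :: "'a set" and r :: "'a rel" and g :: "'a set \<Rightarrow> 'a set"
  assumes "partial_order_on P r"
    and "g \<in> Pow P \<rightarrow> Pow P"
  shows "\<exists>U. good_chain P r g U \<and> (\<forall>C. good_chain P r g C \<longrightarrow> C \<subseteq> U)"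
proof -
  define U where "U = \<Union>{C. good_chain P r g C}"
  have chain: "U \<in> Chains r"
    unfolding U_def by (rule Union_good_chains)
  have seg: "segment r C U" if "good_chain P r g C" for C
    unfolding U_def using that by (rule Union_good_chains)
  have "strict_segment r S (g S) \<and> segment r (g S) U" if S: "strict_segment r S U" for S
  proof -
    from S obtain x where "x \<in> U" "x \<notin> S"
      by (auto simp: strict_segment_def segment_def)
    then obtain C where C: "good_chain P r g C" "x \<in> C"
      unfolding U_def by blast
    have "strict_segment r S C"
      using strict_segment_of_segment[OF chain _ seg[OF C(1)] C(2) \<open>x \<notin> S\<close>] S
      by (simp add: strict_segment_def)
    then have "strict_segment r S (g S)" "segment r (g S) C"
      using C(1) by (auto simp: good_chain_def)
    then show ?thesis
      using segment_trans seg[OF C(1)] by blast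
  qed
  moreover have "U \<subseteq> P"
    unfolding U_def good_chain_def by blast
  ultimately have "good_chain P r g U"
    using chain by (simp add: good_chain_def)
  then show ?thesis
    unfolding U_def by blast
qed

end
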